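(* Let $P=\{v_1,\dots,v_n\}$ be a finite poset with order $\le$, and let $J_P\subset\mathbb{C}[x_1,\dots,x_n]$ be the ideal $$J_P=\Big\langle x_i-x_i\prod_{v_j\le v_i}x_j \;:\; v_i\in P\Big\rangle .$$ Then the set $Gb_P$ consisting of the polynomials $$gb_i=x_i^2-x_i\quad (v_i\in P),\qquad gb_{(j,i)}=x_ix_j-x_i\quad (v_j\le v_i)$$ is the universal reduced Gröbner basis of $J_P$; that is, for every monomial order on $\mathbb{C}[x_1,\dots,x_n]$, $Gb_P$ is the reduced Gröbner basis of $J_P$.
   Context: The product $\prod_{v_j\le v_i}x_j$ runs over all $j$ with $v_j\le v_i$, including $j=i$. *)

theory Defs
  imports Complex_Main "HOL-Library.Poly_Mapping"
begin

text \<open>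
  Monomials are exponent vectors and polynomials are finitely supported coefficient functions
  on them; multiplication in \<^typ>\<open>(nat \<Rightarrow>\<^sub>0 nat) \<Rightarrow>\<^sub>0 complex\<close> is convolution, i.e. the usual
  product. The type has a variable for every natural number, so the ring
  $\mathbb{C}[x_1,\dots,x_n]$ is the carrier \<open>polys n\<close>.
\<close>

type_synonym monom = "nat \<Rightarrow>\<^sub>0 nat"
type_synonym cpoly = "monom \<Rightarrow>\<^sub>0 complex"

definition monoms :: "nat \<Rightarrow> monom set" where
  "monoms n = {m. Poly_Mapping.keys m \<subseteq> {1..n}}"

definition polys :: "nat \<Rightarrow> cpoly set" where
  "polys n = {p. Poly_Mapping.keys p \<subseteq> monoms n}"

definition var :: "nat \<Rightarrow> cpoly" where
  "var i = Poly_Mapping.single (Poly_Mapping.single i 1) 1"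

definition ideal_gen :: "nat \<Rightarrow> cpoly set \<Rightarrow> cpoly set" where
  "ideal_gen n F =
    {\<Sum>f\<in>A. q f * f | A q. finite A \<and> A \<subseteq> F \<and> (\<forall>f\<in>A. q f \<in> polys n)}"

text \<open>
  As in the definition of \<^const>\<open>well_order_on\<close>, \<open>(s, t) \<in> ord\<close> stands for the
  reflexive comparison of \<open>s\<close> and \<open>t\<close>, \<open>s\<close> being the smaller one. Exponent vectors are
  written additively, so \<open>s + u\<close> is the product of the monomials \<open>s\<close> and \<open>u\<close>.
\<close>

definition monomial_order :: "nat \<Rightarrow> monom rel \<Rightarrow> bool" where
  "monomial_order n ord \<longleftrightarrow>
    well_order_on (monoms n) ord \<and>
    (\<forall>s t. \<forall>u\<in>monoms n. (s, t) \<in> ord \<longrightarrow> (s + u, t + u) \<in> ord)"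

text \<open>The next three notions are only meaningful for nonzero polynomials in \<open>polys n\<close>.\<close>

definition lead_monom :: "monom rel \<Rightarrow> cpoly \<Rightarrow> monom" where
  "lead_monom ord p =
    (THE m. m \<in> Poly_Mapping.keys p \<and> (\<forall>k\<in>Poly_Mapping.keys p. (k, m) \<in> ord))"

definition lead_coef :: "monom rel \<Rightarrow> cpoly \<Rightarrow> complex" where
  "lead_coef ord p = Poly_Mapping.lookup p (lead_monom ord p)"

definition lead_term :: "monom rel \<Rightarrow> cpoly \<Rightarrow> cpoly" where
  "lead_term ord p = Poly_Mapping.single (lead_monom ord p) (lead_coef ord p)"

definition lead_ideal :: "nat \<Rightarrow> monom rel \<Rightarrow> cpoly set \<Rightarrow> cpoly set" where
  "lead_ideal n ord F = ideal_gen n (lead_term ord ` (F - {0}))"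

definition groebner_basis :: "nat \<Rightarrow> monom rel \<Rightarrow> cpoly set \<Rightarrow> cpoly set \<Rightarrow> bool" where
  "groebner_basis n ord I G \<longleftrightarrow>
    finite G \<and> G \<subseteq> I \<and> lead_ideal n ord G = lead_ideal n ord I"

text \<open>The condition on leading coefficients excludes \<open>0\<close> from a reduced Groebner basis.\<close>

definition reduced_groebner_basis ::
    "nat \<Rightarrow> monom rel \<Rightarrow> cpoly set \<Rightarrow> cpoly set \<Rightarrow> bool" where
  "reduced_groebner_basis n ord I G \<longleftrightarrow>
    groebner_basis n ord I G \<and>
    (\<forall>g\<in>G. lead_coef ord g = 1 \<and>
      (\<forall>m\<in>Poly_Mapping.keys g. Poly_Mapping.single m 1 \<notin> lead_ideal n ord (G - {g})))"

text \<open>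
  In the two definitions below the poset is \<open>{v 1, \<dots>, v n}\<close>, with \<open>(a, b) \<in> r\<close> meaning
  $a \le b$.
\<close>

definition poset_ideal :: "nat \<Rightarrow> (nat \<Rightarrow> 'a) \<Rightarrow> 'a rel \<Rightarrow> cpoly set" where
  "poset_ideal n v r = ideal_gen n
    {var i - var i * (\<Prod>j\<in>{j\<in>{1..n}. (v j, v i) \<in> r}. var j) | i. i \<in> {1..n}}"

definition poset_gb :: "nat \<Rightarrow> (nat \<Rightarrow> 'a) \<Rightarrow> 'a rel \<Rightarrow> cpoly set" where
  "poset_gb n v r =
    {var i ^ 2 - var i | i. i \<in> {1..n}} \<union>
    {var i * var j - var i | i j. i \<in> {1..n} \<and> j \<in> {1..n} \<and> (v j, v i) \<in> r}"

end

theory Submission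
  imports Defs
begin

text \<open>
  Modulo \<open>J\<^sub>P\<close> the relations $x_i x_j = x_i$ for
  $v_j \le v_i$ follow by induction along the poset (\<open>comparable_pair_in_poset_ideal\<close>), so \<open>Gb\<^sub>P\<close> lies in
  \<open>J\<^sub>P\<close>. In every monomial order $x_i x_j$ exceeds its divisor $x_i$, so the leading monomials of
  \<open>Gb\<^sub>P\<close> are the products of two comparable variables, squares included. The monomials divisible
  by none of them are the squarefree products over antichains.

  For the Groebner property it remains to see that no nonzero \<open>f\<close> in \<open>J\<^sub>P\<close> has such an antichain
  monomial as its leading monomial (\<open>lead_divisible_by_pair\<close>). The generators of \<open>J\<^sub>P\<close> are
  differences of two monomials whose supports generate the same lower set of the poset, and
  multiplication by a monomial preserves this. Hence for every lower set \<open>D\<close> the coefficients of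
  an element of \<open>J\<^sub>P\<close> at the monomials whose support generates \<open>D\<close> add up to zero
  (\<open>coeff_sum_poset_ideal\<close>). An antichain is the set of maximal elements of the lower set that it
  generates, so every other monomial with the same lower set is a proper multiple of the antichain
  monomial, and is therefore larger in the order. If the leading monomial were an antichain
  monomial, the sum over its lower set would consist of the leading coefficient alone, which is not
  zero. This replaces a computation of S-polynomials and treats all monomial orders at once.

  No monomial of an element of \<open>Gb\<^sub>P\<close> is a multiple of the leading monomial of another one, by
  degree and by antisymmetry of the poset, so the basis is reduced. That it is the only one is the
  general uniqueness of reduced Groebner bases (\<open>reduced_groebner_basis_unique\<close>).
\<close>

section \<open>Polynomials and ideals in finitely many variables\<close>

lemma monoms_add_iff: "a + b \<in> monoms n \<longleftrightarrow> a \<in> monoms n \<and> b \<in> monoms n"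
proof -
  have "Poly_Mapping.keys (a + b) = Poly_Mapping.keys a \<union> Poly_Mapping.keys b"
    by (auto simp: in_keys_iff lookup_add)
  then show ?thesis by (simp add: monoms_def)
qed

lemma zero_in_monoms: "0 \<in> monoms n"
  by (simp add: monoms_def)

lemma zero_in_polys: "0 \<in> polys n"
  by (simp add: polys_def)

lemma single_in_polys: "m \<in> monoms n \<Longrightarrow> Poly_Mapping.single m c \<in> polys n"
  by (simp add: polys_def)

lemma one_in_polys: "1 \<in> polys n"
  by (simp add: polys_def zero_in_monoms)

lemma polys_add: "p \<in> polys n \<Longrightarrow> q \<in> polys n \<Longrightarrow> p + q \<in> polys n"
  using keys_add[of p q] by (auto simp: polys_def)

lemma polys_diff: "p \<in> polys n \<Longrightarrow> q \<in> polys n \<Longrightarrow> p - q \<in> polys n"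
  using keys_add[of p "- q"] by (auto simp: polys_def)

lemma polys_mult: "p \<in> polys n \<Longrightarrow> q \<in> polys n \<Longrightarrow> p * q \<in> polys n"
  using keys_mult[of p q] by (fastforce simp: polys_def monoms_add_iff)

lemma var_in_polys: "i \<in> {1..n} \<Longrightarrow> var i \<in> polys n"
  by (auto simp: var_def monoms_def intro!: single_in_polys)

lemma prod_var_in_polys: "A \<subseteq> {1..n} \<Longrightarrow> (\<Prod>j\<in>A. var j) \<in> polys n"
  by (induction A rule: infinite_finite_induct) (auto intro!: one_in_polys polys_mult var_in_polys)

lemma prod_var_eq_single:
  "finite A \<Longrightarrow> (\<Prod>j\<in>A. var j) = Poly_Mapping.single (\<Sum>j\<in>A. Poly_Mapping.single j 1) 1"
  by (induction A rule: finite_induct) (auto simp: var_def mult_single)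

lemma ideal_gen_zero: "0 \<in> ideal_gen n F"
  unfolding ideal_gen_def by (rule CollectI, rule exI[of _ "{}"]) auto

lemma ideal_gen_add:
  assumes "p \<in> ideal_gen n F" "p' \<in> ideal_gen n F"
  shows "p + p' \<in> ideal_gen n F"
proof -
  obtain A q where A: "finite A" "A \<subseteq> F" "\<forall>f\<in>A. q f \<in> polys n" and p: "p = (\<Sum>f\<in>A. q f * f)"
    using assms(1) by (auto simp: ideal_gen_def)
  obtain B s where B: "finite B" "B \<subseteq> F" "\<forall>f\<in>B. s f \<in> polys n" and p': "p' = (\<Sum>f\<in>B. s f * f)"
    using assms(2) by (auto simp: ideal_gen_def)
  let ?t = "\<lambda>f. (if f \<in> A then q f else 0) + (if f \<in> B then s f else 0)"
  have "p = (\<Sum>f\<in>A \<union> B. (if f \<in> A then q f else 0) * f)"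
    unfolding p using A(1) B(1) by (intro sum.mono_neutral_cong_left) auto
  moreover have "p' = (\<Sum>f\<in>A \<union> B. (if f \<in> B then s f else 0) * f)"
    unfolding p' using A(1) B(1) by (intro sum.mono_neutral_cong_left) auto
  ultimately have "p + p' = (\<Sum>f\<in>A \<union> B. ?t f * f)"
    by (simp add: sum.distrib distrib_right)
  moreover have "\<forall>f\<in>A \<union> B. ?t f \<in> polys n"
    using A(3) B(3) by (auto intro!: polys_add zero_in_polys)
  ultimately show ?thesis
    using A B unfolding ideal_gen_def
    by (intro CollectI exI[of _ "A \<union> B"] exI[of _ ?t]) auto
qed

lemma ideal_gen_mult:
  assumes "p \<in> ideal_gen n F" "s \<in> polys n"
  shows "s * p \<in> ideal_gen n F"
proof -
  obtain A q where A: "finite A" "A \<subseteq> F" "\<forall>f\<in>A. q f \<in> polys n" and p: "p = (\<Sum>f\<in>A. q f * f)"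
    using assms(1) by (auto simp: ideal_gen_def)
  have "s * p = (\<Sum>f\<in>A. (s * q f) * f)"
    by (simp add: p sum_distrib_left mult.assoc)
  moreover have "\<forall>f\<in>A. s * q f \<in> polys n"
    using A assms(2) by (auto intro: polys_mult)
  ultimately show ?thesis
    using A unfolding ideal_gen_def
    by (intro CollectI exI[of _ A] exI[of _ "\<lambda>f. s * q f"]) auto
qed

lemma ideal_gen_diff:
  assumes "p \<in> ideal_gen n F" "q \<in> ideal_gen n F"
  shows "p - q \<in> ideal_gen n F"
proof -
  have "0 - 1 \<in> polys n" by (intro polys_diff zero_in_polys one_in_polys)
  then have "(0 - 1) * q \<in> ideal_gen n F" using assms(2) by (intro ideal_gen_mult)
  from ideal_gen_add[OF assms(1) this] show ?thesis by simp
qed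

lemma ideal_gen_base: "f \<in> F \<Longrightarrow> f \<in> ideal_gen n F"
  unfolding ideal_gen_def
  by (intro CollectI exI[of _ "{f}"] exI[of _ "\<lambda>_. 1"]) (auto intro: one_in_polys)

lemma ideal_gen_least:
  assumes "0 \<in> C" "\<And>p q. p \<in> C \<Longrightarrow> q \<in> C \<Longrightarrow> p + q \<in> C"
    and "\<And>q f. q \<in> polys n \<Longrightarrow> f \<in> F \<Longrightarrow> q * f \<in> C"
  shows "ideal_gen n F \<subseteq> C"
proof
  fix p assume "p \<in> ideal_gen n F"
  then obtain A q where A: "finite A" "A \<subseteq> F" "\<forall>f\<in>A. q f \<in> polys n"
    and p: "p = (\<Sum>f\<in>A. q f * f)"
    by (auto simp: ideal_gen_def)
  show "p \<in> C" unfolding p using A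
    by (induction A rule: finite_induct) (auto intro!: assms)
qed

lemma ideal_gen_subset: "F \<subseteq> ideal_gen n F' \<Longrightarrow> ideal_gen n F \<subseteq> ideal_gen n F'"
  by (rule ideal_gen_least) (auto intro: ideal_gen_zero ideal_gen_add ideal_gen_mult)

lemma ideal_gen_mono: "F \<subseteq> F' \<Longrightarrow> ideal_gen n F \<subseteq> ideal_gen n F'"
  by (rule ideal_gen_subset) (auto intro: ideal_gen_base)

lemma ideal_gen_in_polys: "F \<subseteq> polys n \<Longrightarrow> ideal_gen n F \<subseteq> polys n"
  by (rule ideal_gen_least) (auto intro: zero_in_polys polys_add polys_mult)

lemma monom_divides:
  fixes t m :: monom
  assumes "\<And>k. Poly_Mapping.lookup t k \<le> Poly_Mapping.lookup m k"
  shows "\<exists>u. m = u + t"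
  by (rule exI[of _ "m - t"]) (auto intro!: poly_mapping_eqI simp: lookup_add lookup_minus assms)

text \<open>
  A leading ideal is a monomial ideal: membership is decided monomial by monomial, through
  divisibility by the leading monomials of the given polynomials. The converse direction is
  \<open>single_in_lead_ideal\<close> below.
\<close>

lemma key_of_lead_ideal:
  assumes "p \<in> lead_ideal n ord F" "m \<in> Poly_Mapping.keys p"
  shows "\<exists>f\<in>F - {0}. \<exists>u. m = u + lead_monom ord f"
proof -
  let ?C = "{p. \<forall>m\<in>Poly_Mapping.keys p. \<exists>f\<in>F - {0}. \<exists>u. m = u + lead_monom ord f}"
  have "lead_ideal n ord F \<subseteq> ?C" unfolding lead_ideal_def
  proof (rule ideal_gen_least)
    show "p + q \<in> ?C" if "p \<in> ?C" "q \<in> ?C" for p q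
      using that keys_add[of p q] by blast
    show "q * g \<in> ?C" if g: "g \<in> lead_term ord ` (F - {0})" for q g
    proof -
      obtain f where f: "f \<in> F - {0}" "g = lead_term ord f" using g by blast
      have "Poly_Mapping.keys g \<subseteq> {lead_monom ord f}" by (simp add: f(2) lead_term_def)
      with keys_mult[of q g] f(1) show ?thesis by blast
    qed
  qed simp
  with assms show ?thesis by blast
qed

section \<open>Monomial orders and leading monomials\<close>

locale monomial_ordering =
  fixes n :: nat and ord :: "monom rel"
  assumes monomial_order: "monomial_order n ord"
begin

lemma linear: "linear_order_on (monoms n) ord"
  using monomial_order by (simp add: monomial_order_def well_order_on_def)

lemma ord_refl: "m \<in> monoms n \<Longrightarrow> (m, m) \<in> ord"
  using linear by (auto simp: order_on_defs refl_on_def)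

lemma ord_trans: "(a, b) \<in> ord \<Longrightarrow> (b, c) \<in> ord \<Longrightarrow> (a, c) \<in> ord"
  using linear by (auto simp: order_on_defs dest: transD)

lemma ord_antisym: "(a, b) \<in> ord \<Longrightarrow> (b, a) \<in> ord \<Longrightarrow> a = b"
  using linear by (auto simp: order_on_defs dest: antisymD)

lemma ord_total: "a \<in> monoms n \<Longrightarrow> b \<in> monoms n \<Longrightarrow> (a, b) \<in> ord \<or> (b, a) \<in> ord"
  using linear ord_refl by (cases "a = b") (auto simp: order_on_defs total_on_def)

lemma ord_add: "(s, t) \<in> ord \<Longrightarrow> u \<in> monoms n \<Longrightarrow> (s + u, t + u) \<in> ord"
  using monomial_order by (auto simp: monomial_order_def)

text \<open>
  The least monomial \<open>m\<close> is \<open>0\<close>: from \<open>m \<le> 0\<close> translation gives \<open>m + m \<le> m\<close>, so \<open>m + m = m\<close>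
  by leastness.
\<close>

lemma zero_least:
  assumes "s \<in> monoms n"
  shows "(0, s) \<in> ord"
proof -
  have wf: "wf (ord - Id)" using monomial_order by (simp add: monomial_order_def well_order_on_def)
  obtain m where m: "m \<in> monoms n" and min: "\<And>y. (y, m) \<in> ord - Id \<Longrightarrow> y \<notin> monoms n"
    using wfE_min[OF wf assms] by blast
  have least: "(m, y) \<in> ord" if "y \<in> monoms n" for y
    using ord_total[OF m that] min[of y] that ord_refl[OF m] by auto
  have "(m + m, 0 + m) \<in> ord"
    using ord_add[OF least[OF zero_in_monoms] m] .
  moreover have "(m, m + m) \<in> ord"
    using least m by (simp add: monoms_add_iff)
  ultimately have "m + m = m" using ord_antisym[of "m + m" m] by simp
  then have "m = 0" by simp
  with least assms show ?thesis by simp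
qed

lemma ord_multiple:
  assumes "u + s \<in> monoms n"
  shows "(s, u + s) \<in> ord"
  using ord_add[OF zero_least, of u s] assms by (simp add: monoms_add_iff)

lemma lead_monom_eqI:
  assumes "m \<in> Poly_Mapping.keys p" "\<And>k. k \<in> Poly_Mapping.keys p \<Longrightarrow> (k, m) \<in> ord"
  shows "lead_monom ord p = m"
  unfolding lead_monom_def using assms by (auto intro: ord_antisym)

lemma finite_has_greatest:
  assumes "finite A" "A \<noteq> {}" "A \<subseteq> monoms n"
  shows "\<exists>m\<in>A. \<forall>k\<in>A. (k, m) \<in> ord"
  using assms
proof (induction A rule: finite_ne_induct)
  case (singleton x)
  then show ?case by (auto intro: ord_refl)
next
  case (insert x A)
  then obtain m where m: "m \<in> A" "\<forall>k\<in>A. (k, m) \<in> ord" by auto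
  show ?case
  proof (cases "(x, m) \<in> ord")
    case False
    then have "(m, x) \<in> ord" using ord_total[of x m] m(1) insert.prems by auto
    then show ?thesis using m insert.prems by (auto intro: ord_trans ord_refl)
  qed (use m in auto)
qed

lemma
  assumes "p \<in> polys n" "p \<noteq> 0"
  shows lead_monom_in_keys: "lead_monom ord p \<in> Poly_Mapping.keys p"
    and lead_monom_greatest: "k \<in> Poly_Mapping.keys p \<Longrightarrow> (k, lead_monom ord p) \<in> ord"
proof -
  obtain m where m: "m \<in> Poly_Mapping.keys p" "\<forall>k\<in>Poly_Mapping.keys p. (k, m) \<in> ord"
    using finite_has_greatest[of "Poly_Mapping.keys p"] assms by (auto simp: polys_def)
  then have "lead_monom ord p = m" by (intro lead_monom_eqI) auto
  with m show "lead_monom ord p \<in> Poly_Mapping.keys p"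
    and "k \<in> Poly_Mapping.keys p \<Longrightarrow> (k, lead_monom ord p) \<in> ord"
    by auto
qed

lemma lead_monom_in_monoms: "p \<in> polys n \<Longrightarrow> p \<noteq> 0 \<Longrightarrow> lead_monom ord p \<in> monoms n"
  using lead_monom_in_keys[of p] by (auto simp: polys_def)

lemma single_in_lead_ideal:
  assumes f: "f \<in> F - {0}" "f \<in> polys n" and m: "m \<in> monoms n" "m = u + lead_monom ord f"
  shows "Poly_Mapping.single m c \<in> lead_ideal n ord F"
proof -
  have lc: "lead_coef ord f \<noteq> 0"
    using lead_monom_in_keys[of f] f by (auto simp: lead_coef_def in_keys_iff)
  have u: "u \<in> monoms n" using m by (simp add: monoms_add_iff)
  have "Poly_Mapping.single u (c / lead_coef ord f) * lead_term ord f \<in> lead_ideal n ord F"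
    unfolding lead_ideal_def using f u
    by (intro ideal_gen_mult ideal_gen_base single_in_polys imageI)
  then show ?thesis using lc m(2) by (simp add: lead_term_def mult_single)
qed

section \<open>Uniqueness of reduced Groebner bases\<close>

lemma reduced_groebner_basis_nonzero:
  assumes "reduced_groebner_basis n ord I G"
  shows "0 \<notin> G"
  using assms by (auto simp: reduced_groebner_basis_def lead_coef_def)

lemma groebner_basis_divides_lead:
  assumes "I \<subseteq> polys n" "groebner_basis n ord I G" "f \<in> I" "f \<noteq> 0"
  shows "\<exists>g\<in>G - {0}. \<exists>u. lead_monom ord f = u + lead_monom ord g"
proof -
  have f: "f \<in> polys n" using assms by auto
  have "Poly_Mapping.single (lead_monom ord f) 1 \<in> lead_ideal n ord I"
    using assms f lead_monom_in_monoms
    by (intro single_in_lead_ideal[of f _ _ 0]) auto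
  then have "Poly_Mapping.single (lead_monom ord f) 1 \<in> lead_ideal n ord G"
    using assms(2) by (simp add: groebner_basis_def)
  from key_of_lead_ideal[OF this] show ?thesis by simp
qed

lemma reduced_groebner_basis_no_divisor:
  assumes "I \<subseteq> polys n" "reduced_groebner_basis n ord I G"
    and "g \<in> G" "m \<in> Poly_Mapping.keys g" "h \<in> G" "m = u + lead_monom ord h"
  shows "h = g"
proof (rule ccontr)
  assume "h \<noteq> g"
  have GI: "G \<subseteq> I" using assms(2)
    by (simp add: reduced_groebner_basis_def groebner_basis_def)
  then have "m \<in> monoms n" using assms by (auto simp: polys_def)
  then have "Poly_Mapping.single m 1 \<in> lead_ideal n ord (G - {g})"
    using assms GI \<open>h \<noteq> g\<close> reduced_groebner_basis_nonzero[OF assms(2)]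
    by (intro single_in_lead_ideal[of h _ m u]) auto
  with assms show False by (auto simp: reduced_groebner_basis_def)
qed

text \<open>
  An element \<open>g\<close> of one reduced basis has its leading monomial divisible by that of some \<open>g'\<close> in the
  other, which in turn is divisible by that of some \<open>h\<close> in the first; reducedness gives \<open>h = g\<close>, so
  \<open>g\<close> and \<open>g'\<close> share their leading monomial. If \<open>g - g'\<close> were nonzero, its leading monomial would be
  a lower monomial of \<open>g\<close> or \<open>g'\<close> that lies in the leading ideal, against reducedness of the basis
  containing that polynomial.
\<close>

lemma reduced_groebner_basis_subset:
  assumes "F \<subseteq> polys n" "reduced_groebner_basis n ord (ideal_gen n F) G"
    and "reduced_groebner_basis n ord (ideal_gen n F) G'"
  shows "G \<subseteq> G'"
proof
  let ?I = "ideal_gen n F"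
  let ?lm = "lead_monom ord"
  have I: "?I \<subseteq> polys n" using assms(1) by (rule ideal_gen_in_polys)
  have gb: "groebner_basis n ord ?I G" "groebner_basis n ord ?I G'"
    using assms by (simp_all add: reduced_groebner_basis_def)
  then have GI: "G \<subseteq> ?I" "G' \<subseteq> ?I" by (simp_all add: groebner_basis_def)
  fix g assume g: "g \<in> G"
  have g0: "g \<noteq> 0" using g reduced_groebner_basis_nonzero[OF assms(2)] by auto
  have gp: "g \<in> polys n" using g GI I by auto
  obtain g' u where g': "g' \<in> G'" "g' \<noteq> 0" and u: "?lm g = u + ?lm g'"
    using groebner_basis_divides_lead[OF I gb(2), of g] g g0 GI by auto
  have gp': "g' \<in> polys n" using g' GI I by auto
  obtain h w where h: "h \<in> G" and w: "?lm g' = w + ?lm h"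
    using groebner_basis_divides_lead[OF I gb(1), of g'] g' GI by auto
  have "?lm g = (u + w) + ?lm h" using u w by (simp add: add.assoc)
  then have "h = g"
    using reduced_groebner_basis_no_divisor[OF I assms(2) g lead_monom_in_keys[OF gp g0] h] by blast
  then have w': "?lm g' = w + ?lm g" using w by simp
  have "(?lm g, ?lm g') \<in> ord"
    unfolding w' using lead_monom_in_monoms[OF gp' g'(2)] w' by (intro ord_multiple) simp
  moreover have "(?lm g', ?lm g) \<in> ord"
    unfolding u using lead_monom_in_monoms[OF gp g0] u by (intro ord_multiple) simp
  ultimately have lm: "?lm g = ?lm g'" by (rule ord_antisym)
  have "g = g'"
  proof (rule ccontr)
    assume ne: "g \<noteq> g'"
    let ?d = "g - g'"
    have d0: "?d \<noteq> 0" using ne by simp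
    have dI: "?d \<in> ?I" using g g' GI by (auto intro: ideal_gen_diff)
    then have dp: "?d \<in> polys n" using I by auto
    let ?m = "?lm ?d"
    have m: "?m \<in> Poly_Mapping.keys ?d" using lead_monom_in_keys[OF dp d0] .
    have "lead_coef ord g = 1" "lead_coef ord g' = 1"
      using assms g g' by (auto simp: reduced_groebner_basis_def)
    then have "Poly_Mapping.lookup ?d (?lm g) = 0"
      by (simp add: lookup_minus lead_coef_def lm)
    then have mne: "?m \<noteq> ?lm g" using m by (auto simp: in_keys_iff)
    have mk: "?m \<in> Poly_Mapping.keys g \<or> ?m \<in> Poly_Mapping.keys g'"
      using m by (auto simp: in_keys_iff lookup_minus)
    then have mle: "(?m, ?lm g) \<in> ord"
      using lead_monom_greatest[OF gp g0] lead_monom_greatest[OF gp' g'(2)] lm by auto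
    have mm: "?m \<in> monoms n" using lead_monom_in_monoms[OF dp d0] .
    \<comment> \<open>\<open>?m\<close> lies strictly below the common leading monomial, so it is no multiple of it.\<close>
    have nd: "?m \<noteq> x + ?lm g" for x
      using ord_multiple[of x "?lm g"] mm mle mne ord_antisym by metis
    from mk show False
    proof
      assume "?m \<in> Poly_Mapping.keys g"
      moreover obtain k x where "k \<in> G" "?m = x + ?lm k"
        using groebner_basis_divides_lead[OF I gb(1) dI d0] by auto
      ultimately show False
        using reduced_groebner_basis_no_divisor[OF I assms(2) g] nd by metis
    next
      assume "?m \<in> Poly_Mapping.keys g'"
      moreover obtain k x where "k \<in> G'" "?m = x + ?lm k"
        using groebner_basis_divides_lead[OF I gb(2) dI d0] by auto
      ultimately show False
        using reduced_groebner_basis_no_divisor[OF I assms(3) g'(1)] nd lm by metis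
    qed
  qed
  with g'(1) show "g \<in> G'" by simp
qed

lemma reduced_groebner_basis_unique:
  assumes "F \<subseteq> polys n" "reduced_groebner_basis n ord (ideal_gen n F) G"
    and "reduced_groebner_basis n ord (ideal_gen n F) G'"
  shows "G = G'"
  using reduced_groebner_basis_subset[OF assms] reduced_groebner_basis_subset[OF assms(1,3,2)]
  by (rule subset_antisym)

end

section \<open>Coefficient sums over sets of monomials\<close>

definition coeff_sum :: "monom set \<Rightarrow> cpoly \<Rightarrow> complex" where
  "coeff_sum S p = (\<Sum>m\<in>Poly_Mapping.keys p. if m \<in> S then Poly_Mapping.lookup p m else 0)"

lemma coeff_sum_zero: "coeff_sum S 0 = 0"
  by (simp add: coeff_sum_def)

lemma coeff_sum_single: "coeff_sum S (Poly_Mapping.single m c) = (if m \<in> S then c else 0)"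
  by (simp add: coeff_sum_def)

lemma coeff_sum_add: "coeff_sum S (p + q) = coeff_sum S p + coeff_sum S q"
  unfolding coeff_sum_def
  using setsum_keys_plus_distrib[of "\<lambda>m c. if m \<in> S then c else 0" p q] by (simp add: lookup_add)

lemma coeff_sum_diff: "coeff_sum S (p - q) = coeff_sum S p - coeff_sum S q"
  using coeff_sum_add[of S "p - q" q] by simp

lemma coeff_sum_sum: "coeff_sum S (\<Sum>x\<in>A. f x) = (\<Sum>x\<in>A. coeff_sum S (f x))"
  by (induction A rule: infinite_finite_induct) (auto simp: coeff_sum_zero coeff_sum_add)

lemma poly_eq_sum_single:
  fixes p :: cpoly
  shows "p = (\<Sum>m\<in>Poly_Mapping.keys p. Poly_Mapping.single m (Poly_Mapping.lookup p m))"
proof (rule poly_mapping_eqI)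
  fix k
  show "Poly_Mapping.lookup p k = Poly_Mapping.lookup
      (\<Sum>m\<in>Poly_Mapping.keys p. Poly_Mapping.single m (Poly_Mapping.lookup p m)) k"
    by (simp add: lookup_sum lookup_single when_def in_keys_iff)
qed

text \<open>
  Multiples of $x^a - x^b$ are combinations of the differences $x^{m+a} - x^{m+b}$, and the two
  monomials of each difference lie both inside or both outside \<open>S\<close>.
\<close>

lemma coeff_sum_mult_binomial:
  assumes "\<And>m. m + a \<in> S \<longleftrightarrow> m + b \<in> S"
  shows "coeff_sum S (q * (Poly_Mapping.single a 1 - Poly_Mapping.single b 1)) = 0"
proof -
  let ?s = "Poly_Mapping.single :: monom \<Rightarrow> complex \<Rightarrow> cpoly"
  have "coeff_sum S (q * (?s a 1 - ?s b 1)) =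
    coeff_sum S ((\<Sum>m\<in>Poly_Mapping.keys q. ?s m (Poly_Mapping.lookup q m)) * (?s a 1 - ?s b 1))"
    using poly_eq_sum_single[of q] by simp
  also have "\<dots> = 0"
    by (simp add: sum_distrib_right coeff_sum_sum right_diff_distrib mult_single coeff_sum_diff
        coeff_sum_single assms)
  finally show ?thesis .
qed

section \<open>The poset ideal\<close>

locale labelled_poset =
  fixes n :: nat and P :: "'a set" and r :: "'a rel" and v :: "nat \<Rightarrow> 'a"
  assumes order: "partial_order_on P r"
    and labelling: "bij_betw v {1..n} P"
begin

definition below :: "nat \<Rightarrow> nat \<Rightarrow> bool" where
  "below j i \<longleftrightarrow> j \<in> {1..n} \<and> i \<in> {1..n} \<and> (v j, v i) \<in> r"

lemma below_refl: "i \<in> {1..n} \<Longrightarrow> below i i"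
  using order labelling unfolding below_def
  by (auto simp: order_on_defs refl_on_def bij_betw_def)

lemma below_trans: "below i j \<Longrightarrow> below j k \<Longrightarrow> below i k"
  using order unfolding below_def by (auto simp: order_on_defs dest: transD)

lemma below_antisym: "below i j \<Longrightarrow> below j i \<Longrightarrow> i = j"
  using order labelling unfolding below_def
  by (auto simp: order_on_defs bij_betw_def dest: antisymD inj_onD)

definition lower_set :: "nat \<Rightarrow> nat set" where
  "lower_set i = {j. below j i}"

lemma finite_lower_set: "finite (lower_set i)"
  by (rule finite_subset[of _ "{1..n}"]) (auto simp: lower_set_def below_def)

definition generator :: "nat \<Rightarrow> cpoly" where
  "generator i = var i - var i * (\<Prod>j\<in>lower_set i. var j)"

lemma poset_ideal_eq: "poset_ideal n v r = ideal_gen n (generator ` {1..n})"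
proof -
  have "lower_set i = {j \<in> {1..n}. (v j, v i) \<in> r}" if "i \<in> {1..n}" for i
    using that by (auto simp: lower_set_def below_def)
  then show ?thesis
    by (auto simp: poset_ideal_def generator_def intro!: arg_cong[of _ _ "ideal_gen n"])
qed

lemma lower_set_subset: "lower_set i \<subseteq> {1..n}"
  by (auto simp: lower_set_def below_def)

lemma generators_in_polys: "generator ` {1..n} \<subseteq> polys n"
  by (auto simp: generator_def
      intro!: polys_diff polys_mult var_in_polys prod_var_in_polys[OF lower_set_subset])

lemma poset_gb_eq: "poset_gb n v r = {var i * var j - var i | i j. below j i}"
  using below_refl by (auto simp: poset_gb_def below_def power2_eq_square)

text \<open>
  The induction runs over the poset from below: idempotency of all variables strictly below \<open>v i\<close>
  yields $x_i x_k = x_i$ for those variables, this collapses the generator at \<open>i\<close> to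
  $x_i - x_i^2$, and idempotency of $x_i$ itself gives the remaining case \<open>j = i\<close>.
\<close>

lemma comparable_pair_in_poset_ideal:
  assumes "below j i"
  shows "var i * var j - var i \<in> poset_ideal n v r"
  using assms
proof (induction i arbitrary: j rule: measure_induct_rule[of "\<lambda>i. card (lower_set i)"])
  case (less i)
  let ?I = "ideal_gen n (generator ` {1..n})"
  have i: "i \<in> {1..n}" using less.prems by (simp add: below_def)
  have poly: "var k \<in> polys n" if "k \<in> lower_set i" for k
    using that lower_set_subset by (blast intro: var_in_polys)
  have gen: "generator i \<in> ?I" using i by (auto intro: ideal_gen_base)
  have idem_below: "var k * var k - var k \<in> ?I" if k: "below k i" "k \<noteq> i" for k
  proof -
    have "lower_set k \<subseteq> lower_set i"
      unfolding lower_set_def using below_trans[OF _ k(1)] by blast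
    moreover have "i \<in> lower_set i" "i \<notin> lower_set k"
      unfolding lower_set_def using below_refl[OF i] below_antisym[OF k(1)] k(2) by blast+
    ultimately have "lower_set k \<subset> lower_set i" by blast
    then have "card (lower_set k) < card (lower_set i)"
      by (rule psubset_card_mono[OF finite_lower_set])
    moreover have "below k k" using k below_refl by (simp add: below_def)
    ultimately show ?thesis using less.IH[of k k] by (simp add: poset_ideal_eq)
  qed
  \<comment> \<open>With \<open>R\<close> the product over \<open>lower_set i\<close> without \<open>k\<close>, the generator is
    \<open>x\<^sub>i - x\<^sub>i x\<^sub>k R\<close>; multiplying by \<open>x\<^sub>k\<close> changes the second term only through \<open>x\<^sub>k\<^sup>2 = x\<^sub>k\<close>.\<close>
  have absorb: "var i * var k - var i \<in> ?I"
    if k: "below k i" and idem: "var k * var k - var k \<in> ?I" for k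
  proof -
    let ?R = "\<Prod>j\<in>lower_set i - {k}. var j"
    have kl: "k \<in> lower_set i" using k by (simp add: lower_set_def)
    have "(\<Prod>j\<in>lower_set i. var j) = var k * ?R"
      using kl finite_lower_set by (simp add: prod.remove)
    then have eq: "var i * var k - var i
        = (var k - 1) * generator i + (var i * ?R) * (var k * var k - var k)"
      by (simp add: generator_def algebra_simps)
    have "?R \<in> polys n" using lower_set_subset by (intro prod_var_in_polys) auto
    then show ?thesis unfolding eq
      using gen idem i poly[OF kl]
      by (intro ideal_gen_add ideal_gen_mult polys_mult polys_diff one_in_polys
          var_in_polys[OF i])
  qed
  have idem: "var i * var i - var i \<in> ?I"
  proof -
    have prod: "var i * (\<Prod>j\<in>B. var j) - var i \<in> ?I" if "finite B" "B \<subseteq> lower_set i - {i}" for B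
      using that
    proof (induction B rule: finite_induct)
      case (insert k B)
      have k: "below k i" "k \<noteq> i" using insert.prems by (auto simp: lower_set_def)
      have eq: "var i * (\<Prod>j\<in>insert k B. var j) - var i
          = var k * (var i * (\<Prod>j\<in>B. var j) - var i) + (var i * var k - var i)"
        using insert.hyps by (simp add: algebra_simps)
      have "var k * (var i * (\<Prod>j\<in>B. var j) - var i) \<in> ?I"
        using insert poly by (intro ideal_gen_mult) auto
      then show ?case
        unfolding eq using absorb[OF k(1) idem_below[OF k]] by (rule ideal_gen_add)
    qed (simp add: ideal_gen_zero)
    let ?R = "\<Prod>j\<in>lower_set i - {i}. var j"
    have il: "i \<in> lower_set i" using below_refl[OF i] by (simp add: lower_set_def)
    have "(\<Prod>j\<in>lower_set i. var j) = var i * ?R"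
      using il finite_lower_set by (simp add: prod.remove)
    then have eq: "var i * var i - var i = 0 - (generator i + var i * (var i * ?R - var i))"
      by (simp add: generator_def algebra_simps)
    have "var i * ?R - var i \<in> ?I" using finite_lower_set by (intro prod) auto
    then have "var i * (var i * ?R - var i) \<in> ?I" using poly[OF il] by (rule ideal_gen_mult)
    with gen show ?thesis unfolding eq
      by (intro ideal_gen_diff[OF ideal_gen_zero] ideal_gen_add)
  qed
  show ?case
    using absorb[OF less.prems] idem idem_below[OF less.prems] unfolding poset_ideal_eq by blast
qed

definition support_lower_set :: "monom \<Rightarrow> nat set" where
  "support_lower_set m = (\<Union>i\<in>Poly_Mapping.keys m. lower_set i)"

lemma support_lower_set_add: "support_lower_set (a + b) = support_lower_set a \<union> support_lower_set b"
proof -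
  have "Poly_Mapping.keys (a + b) = Poly_Mapping.keys a \<union> Poly_Mapping.keys b"
    by (auto simp: in_keys_iff lookup_add)
  then show ?thesis by (simp add: support_lower_set_def)
qed

text \<open>
  The two monomials of the generator at \<open>i\<close> differ by variables below \<open>v i\<close>, which do not enlarge a
  lower set that already contains \<open>v i\<close>.
\<close>

lemma coeff_sum_poset_ideal:
  assumes "p \<in> poset_ideal n v r"
  shows "coeff_sum {m. support_lower_set m = D} p = 0"
proof -
  let ?S = "{m. support_lower_set m = D}"
  have "ideal_gen n (generator ` {1..n}) \<subseteq> {p. coeff_sum ?S p = 0}"
  proof (rule ideal_gen_least)
    fix q g assume "g \<in> generator ` {1..n}"
    then obtain i where i: "i \<in> {1..n}" and g: "g = generator i" by auto
    let ?a = "Poly_Mapping.single i 1 :: monom"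
    let ?b = "(\<Sum>j\<in>lower_set i. Poly_Mapping.single j 1) :: monom"
    have g': "g = Poly_Mapping.single ?a 1 - Poly_Mapping.single (?a + ?b) 1"
      unfolding g generator_def prod_var_eq_single[OF finite_lower_set]
      by (simp add: mult_single var_def)
    have "Poly_Mapping.keys ?b = lower_set i"
      using finite_lower_set
      by (auto simp: in_keys_iff lookup_sum lookup_single when_def split: if_splits)
    then have "support_lower_set ?b \<subseteq> support_lower_set ?a"
      using below_trans by (auto simp: support_lower_set_def lower_set_def)
    then have "support_lower_set (m + ?a) = support_lower_set (m + (?a + ?b))" for m
      by (auto simp: support_lower_set_add)
    then show "q * g \<in> {p. coeff_sum ?S p = 0}"
      unfolding g' using coeff_sum_mult_binomial[of ?a ?S "?a + ?b" q] by simp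
  qed (auto simp: coeff_sum_zero coeff_sum_add)
  with assms show ?thesis by (auto simp: poset_ideal_eq)
qed

abbreviation pair_monom :: "nat \<Rightarrow> nat \<Rightarrow> monom" where
  "pair_monom i j \<equiv> Poly_Mapping.single i 1 + Poly_Mapping.single j 1"

end

locale ordered_labelled_poset = monomial_ordering n ord + labelled_poset n P r v
  for n ord P r v
begin

lemma poset_ideal_in_polys: "poset_ideal n v r \<subseteq> polys n"
  unfolding poset_ideal_eq using generators_in_polys by (rule ideal_gen_in_polys)

text \<open>
  Otherwise the leading monomial is squarefree with an antichain as support. Any monomial with the
  same lower set is a multiple of it, because the maximal elements of that lower set occur in its
  support; so among the monomials of \<open>f\<close> only the leading one has this lower set, and the vanishing
  coefficient sum is the leading coefficient.
\<close>

lemma lead_divisible_by_pair: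
  assumes "f \<in> poset_ideal n v r" "f \<noteq> 0"
  shows "\<exists>i j u. below j i \<and> lead_monom ord f = u + pair_monom i j"
proof (rule ccontr)
  assume none: "\<not> ?thesis"
  let ?m = "lead_monom ord f"
  have f: "f \<in> polys n" using assms poset_ideal_in_polys by auto
  have m: "?m \<in> Poly_Mapping.keys f" "?m \<in> monoms n"
    using lead_monom_in_keys lead_monom_in_monoms f assms(2) by auto
  have range: "i \<in> {1..n}" if "i \<in> Poly_Mapping.keys ?m" for i
    using that m(2) by (auto simp: monoms_def)
  have squarefree: "Poly_Mapping.lookup ?m i \<le> 1" for i
  proof (rule ccontr)
    assume a: "\<not> ?thesis"
    then have "below i i" using range[of i] by (intro below_refl) (simp add: in_keys_iff)
    moreover have "\<exists>u. ?m = u + pair_monom i i"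
      using a by (intro monom_divides) (auto simp: lookup_add lookup_single when_def)
    ultimately show False using none by blast
  qed
  have antichain: "i = j"
    if ij: "i \<in> Poly_Mapping.keys ?m" "j \<in> Poly_Mapping.keys ?m" "below j i" for i j
  proof (rule ccontr)
    assume ne: "i \<noteq> j"
    have "\<exists>u. ?m = u + pair_monom i j"
      using ij ne by (intro monom_divides) (auto simp: lookup_add lookup_single when_def in_keys_iff)
    with ij none show False by blast
  qed
  have only: "k = ?m"
    if k: "k \<in> Poly_Mapping.keys f" "support_lower_set k = support_lower_set ?m" for k
  proof -
    have kn: "k \<in> monoms n" using k f by (auto simp: polys_def)
    have "Poly_Mapping.lookup ?m i \<le> Poly_Mapping.lookup k i" for i
    proof (cases "i \<in> Poly_Mapping.keys ?m")
      case i: True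
      \<comment> \<open>Going up from \<open>i\<close> to the support of \<open>k\<close> and further up to that of \<open>?m\<close> must end at \<open>i\<close>
        again, by the antichain property.\<close>
      have "i \<in> support_lower_set k"
        using i below_refl[OF range[OF i]] k(2) by (auto simp: support_lower_set_def lower_set_def)
      then obtain a where a: "a \<in> Poly_Mapping.keys k" "below i a"
        by (auto simp: support_lower_set_def lower_set_def)
      then have "a \<in> support_lower_set ?m"
        using below_refl[of a] k(2)
        by (auto simp: support_lower_set_def lower_set_def below_def)
      then obtain b where b: "b \<in> Poly_Mapping.keys ?m" "below a b"
        by (auto simp: support_lower_set_def lower_set_def)
      have "b = i" using antichain[OF b(1) i below_trans[OF a(2) b(2)]] .
      then have "a = i" using below_antisym a(2) b(2) by blast
      then have "1 \<le> Poly_Mapping.lookup k i" using a(1) by (simp add: in_keys_iff)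
      then show ?thesis using squarefree[of i] by simp
    qed (simp add: in_keys_iff)
    then obtain u where "k = u + ?m" using monom_divides by blast
    then have "(?m, k) \<in> ord" using ord_multiple kn by blast
    moreover have "(k, ?m) \<in> ord" using lead_monom_greatest[OF f assms(2) k(1)] .
    ultimately show ?thesis using ord_antisym by blast
  qed
  have "coeff_sum {k. support_lower_set k = support_lower_set ?m} f
      = (\<Sum>k\<in>Poly_Mapping.keys f. if k = ?m then Poly_Mapping.lookup f k else 0)"
    unfolding coeff_sum_def using only by (intro sum.cong) auto
  also have "\<dots> = Poly_Mapping.lookup f ?m" using m(1) by simp
  finally have "Poly_Mapping.lookup f ?m = 0"
    using coeff_sum_poset_ideal[OF assms(1)] by simp
  with m(1) show False by (simp add: in_keys_iff)
qed

lemma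
  assumes "below j i"
  shows keys_pair: "Poly_Mapping.keys (var i * var j - var i) = {pair_monom i j, Poly_Mapping.single i 1}"
    and lead_monom_pair: "lead_monom ord (var i * var j - var i) = pair_monom i j"
    and lead_coef_pair: "lead_coef ord (var i * var j - var i) = 1"
proof -
  have ne: "pair_monom i j \<noteq> Poly_Mapping.single i 1"
    by (metis add_cancel_right_right lookup_single_eq lookup_zero one_neq_zero)
  have eq: "var i * var j - var i =
      Poly_Mapping.single (pair_monom i j) 1 - Poly_Mapping.single (Poly_Mapping.single i 1) 1"
    by (simp add: var_def mult_single)
  show keys: "Poly_Mapping.keys (var i * var j - var i) = {pair_monom i j, Poly_Mapping.single i 1}"
    unfolding eq using ne by (auto simp: in_keys_iff lookup_minus lookup_single when_def split: if_splits)
  have mon: "pair_monom i j \<in> monoms n"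
    using assms unfolding monoms_add_iff by (simp add: monoms_def below_def)
  then have "(Poly_Mapping.single i 1, pair_monom i j) \<in> ord"
    using ord_multiple[of "Poly_Mapping.single j 1" "Poly_Mapping.single i 1"]
    by (simp add: add.commute)
  then show lm: "lead_monom ord (var i * var j - var i) = pair_monom i j"
    using keys mon by (intro lead_monom_eqI) (auto intro: ord_refl)
  show "lead_coef ord (var i * var j - var i) = 1"
    unfolding lead_coef_def lm unfolding eq using ne by (simp add: lookup_minus lookup_single when_def)
qed

text \<open>
  By degree \<open>u\<close> is zero, and the two pairs agree up to order. A swapped pair would be comparable
  both ways, hence diagonal.
\<close>

lemma pair_monom_divides_imp_eq:
  assumes "pair_monom i j = u + pair_monom k l" "below j i" "below l k"
  shows "k = i \<and> l = j"
proof -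
  have eq: "(1 when i = x) + (1 when j = x) = Poly_Mapping.lookup u x + (1 when k = x) + (1 when l = x)"
    for x
    using arg_cong[OF assms(1), of "\<lambda>m. Poly_Mapping.lookup m x"]
    by (simp add: lookup_add lookup_single add.assoc)
  have "k = i \<and> l = j \<or> k = j \<and> l = i"
    using eq[of k] eq[of l] by (auto simp: when_def split: if_splits)
  then show ?thesis using below_antisym assms by blast
qed

lemma single_not_multiple_of_pair: "Poly_Mapping.single i 1 \<noteq> u + pair_monom k l"
proof
  assume a: "Poly_Mapping.single i 1 = u + pair_monom k l"
  have eq: "(1 when i = x) = Poly_Mapping.lookup u x + (1 when k = x) + (1 when l = x)"
    for x
    using arg_cong[OF a, of "\<lambda>m. Poly_Mapping.lookup m x"]
    by (simp add: lookup_add lookup_single add.assoc)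
  show False using eq[of k] eq[of l] by (auto simp: when_def split: if_splits)
qed

lemma poset_gb_groebner: "groebner_basis n ord (poset_ideal n v r) (poset_gb n v r)"
  unfolding groebner_basis_def
proof (intro conjI subset_antisym)
  let ?I = "poset_ideal n v r" and ?G = "poset_gb n v r"
  have "?G \<subseteq> (\<lambda>(i, j). var i * var j - var i) ` ({1..n} \<times> {1..n})"
    by (auto simp: poset_gb_eq below_def)
  then show "finite ?G" by (rule finite_subset) simp
  show GI: "?G \<subseteq> ?I" unfolding poset_gb_eq using comparable_pair_in_poset_ideal by blast
  show "lead_ideal n ord ?G \<subseteq> lead_ideal n ord ?I"
    unfolding lead_ideal_def using GI by (intro ideal_gen_mono) auto
  have "lead_term ord f \<in> lead_ideal n ord ?G" if f: "f \<in> ?I" "f \<noteq> 0" for f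
  proof -
    obtain i j u where ij: "below j i" and u: "lead_monom ord f = u + pair_monom i j"
      using lead_divisible_by_pair[OF f] by blast
    let ?g = "var i * var j - var i"
    have g: "?g \<in> ?G - {0}" "?g \<in> polys n"
      using ij keys_pair[OF ij] GI poset_ideal_in_polys by (auto simp: poset_gb_eq)
    have "lead_monom ord f \<in> monoms n"
      using lead_monom_in_monoms f poset_ideal_in_polys by auto
    then show ?thesis unfolding lead_term_def
      using single_in_lead_ideal[OF g, of "lead_monom ord f" u] u lead_monom_pair[OF ij] by simp
  qed
  then show "lead_ideal n ord ?I \<subseteq> lead_ideal n ord ?G"
    unfolding lead_ideal_def by (intro ideal_gen_subset) auto
qed

lemma poset_gb_reduced: "reduced_groebner_basis n ord (poset_ideal n v r) (poset_gb n v r)"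
  unfolding reduced_groebner_basis_def
proof (intro conjI ballI poset_gb_groebner notI)
  fix g assume "g \<in> poset_gb n v r"
  then obtain i j where ij: "below j i" and g: "g = var i * var j - var i"
    by (auto simp: poset_gb_eq)
  show "lead_coef ord g = 1" using lead_coef_pair[OF ij] g by simp
  fix m assume m: "m \<in> Poly_Mapping.keys g"
    and "Poly_Mapping.single m 1 \<in> lead_ideal n ord (poset_gb n v r - {g})"
  from key_of_lead_ideal[OF this(2), of m] obtain f u
    where f: "f \<in> poset_gb n v r" "f \<noteq> g" and u: "m = u + lead_monom ord f" by auto
  obtain k l where kl: "below l k" and f': "f = var k * var l - var k"
    using f by (auto simp: poset_gb_eq)
  have mu: "m = u + pair_monom k l" using u lead_monom_pair[OF kl] f' by simp
  have "m \<in> {pair_monom i j, Poly_Mapping.single i 1}"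
    using m unfolding g keys_pair[OF ij] .
  then have "pair_monom i j = u + pair_monom k l"
    using single_not_multiple_of_pair[of i u k l] unfolding mu by (metis insertE singletonD)
  then have "k = i \<and> l = j" using ij kl by (rule pair_monom_divides_imp_eq)
  with f(2) f' g show False by simp
qed

end

theorem proposition3p7:
  fixes n :: nat and P :: "'a set" and r :: "'a rel" and v :: "nat \<Rightarrow> 'a"
  assumes "partial_order_on P r"
    and "bij_betw v {1..n} P"
  shows "\<forall>ord. monomial_order n ord \<longrightarrow>
    (\<forall>G. reduced_groebner_basis n ord (poset_ideal n v r) G \<longleftrightarrow> G = poset_gb n v r)"
proof (intro allI impI)
  fix ord G assume "monomial_order n ord"
  then interpret ordered_labelled_poset n ord P r v
    using assms by unfold_locales
  show "reduced_groebner_basis n ord (poset_ideal n v r) G \<longleftrightarrow> G = poset_gb n v r"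
  proof
    assume "reduced_groebner_basis n ord (poset_ideal n v r) G"
    then show "G = poset_gb n v r"
      using poset_gb_reduced unfolding poset_ideal_eq
      by (rule reduced_groebner_basis_unique[OF generators_in_polys])
  qed (simp add: poset_gb_reduced)
qed

end
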